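(* Let $X$ be a tree-shift over a finite alphabet. The following are equivalent. (i) $X$ is irreducible. (ii) For each pair of blocks $u\in B_n(X)$, $v\in B_m(X)$, where $n,m\in\mathbb{N}$, there exist a family $\{P_w\}_{w\in\Sigma^{n-1}}$ with $P_w$ a complete prefix set for every $w\in\Sigma^{n-1}$, and a tree $t\in X$, such that $$t|_{S(u)}=u\quad\text{and}\quad t|_{wxS(v)}=v\ \text{ for all } w\in\Sigma^{n-1},\ x\in P_w.$$ (iii) For each pair of blocks $u\in B_n(X)$, $v\in B_m(X)$, where $n,m\in\mathbb{N}$, there exist, for some $l$, a family $\{P_k\}_{1\le k\le l}$ with $P_k$ a complete prefix set for $1\le k\le l$, and a tree $t\in X$, such that $t|_{S(u)}=u$ and, for each $w\in\Sigma^{n-1}$, there is some $k\in\{1,\dots,l\}$ with $$t|_{wxS(v)}=v\ \text{ for all } x\in P_k.$$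
   Context: Let $\Sigma=\{0,1\}$, let $\Sigma^n$ be the set of words of length $n$ over $\Sigma$ ($\Sigma^0=\{\epsilon\}$, with $\epsilon$ the empty word), $\Sigma^*=\bigcup_{n\ge 0}\Sigma^n$, and $\Sigma_n=\bigcup_{k=0}^n\Sigma^k$; $|x|$ is the length of a word $x$. A (infinite) tree over a finite alphabet $\mathcal{A}$ is a function $t:\Sigma^*\to\mathcal{A}$; write $t_x=t(x)$. A pattern is a function $u:L\to\mathcal{A}$ with $L\subset\Sigma^*$ finite and prefix-closed; $L=S(u)$ is its support. $u$ is a pattern of a tree $t$ rooted at $x\in\Sigma^*$ if $u_y=t_{xy}$ for all $y\in S(u)$; this is also written $t|_{xS(u)}=u$ (and $t|_{S(u)}=u$ when $x=\epsilon$). A tree $t$ avoids $u$ if $u$ is not a pattern of $t$ rooted at any node. A tree-shift is a set of trees of the form $X=\mathsf{X}_{\mathcal{F}}=\{t: t \text{ avoids every } u\in\mathcal{F}\}$ for some collection $\mathcal{F}$ of patterns. An $n$-block ($n\ge1$) is a pattern with support $\Sigma_{n-1}$; $B_n(X)$ is the set of all $n$-blocks that are patterns of some tree in $X$. A set $P\subset\Sigma^*$ is a prefix set if no word in $P$ is a prefix of another word in $P$. For finite $P$, $|P|=\max\{|x|:x\in P\}$. A finite prefix set $P$ is a complete prefix set (CPS) if every $x\in\Sigma^*$ with $|x|\ge|P|$ has a prefix in $P$ (a word counts as a prefix of itself). A tree-shift $X$ is irreducible if for every $n$ and every pair of blocks $u,v\in B_n(X)$ there are a tree $t\in X$ and a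 CPS $P\subset\bigcup_{k\ge n}\Sigma^k$ such that $t|_{S(u)}=u$ and $t|_{xS(v)}=v$ for all $x\in P$. *)

theory Defs
  imports Main "HOL-Library.Sublist"
begin

text \<open>Words over \<open>\<Sigma> = {0, 1}\<close> are lists of Booleans, with \<open>False\<close> and \<open>True\<close> standing for
  0 and 1; \<open>prefix\<close> is the (reflexive) prefix order of \<open>HOL-Library.Sublist\<close>.\<close>

type_synonym word = "bool list"

definition words :: "nat \<Rightarrow> word set" where
  "words n = {x. length x = n}"

definition words_upto :: "nat \<Rightarrow> word set" where
  "words_upto n = (\<Union>k\<in>{0..n}. words k)"

type_synonym 'a tree = "word \<Rightarrow> 'a"

text \<open>A pattern \<open>u : L \<rightarrow> \<A>\<close> is a partial function on words whose domain \<open>L\<close>, the support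
  \<open>S(u)\<close>, is finite and prefix-closed.\<close>

definition prefix_closed :: "word set \<Rightarrow> bool" where
  "prefix_closed L \<longleftrightarrow> (\<forall>x\<in>L. \<forall>y. prefix y x \<longrightarrow> y \<in> L)"

definition is_pattern :: "(word \<rightharpoonup> 'a) \<Rightarrow> bool" where
  "is_pattern u \<longleftrightarrow> finite (dom u) \<and> prefix_closed (dom u)"

text \<open>\<open>pattern_at t x u\<close> means that \<open>u\<close> is a pattern of \<open>t\<close> rooted at \<open>x\<close>, written
  \<open>t|\<^bsub>xS(u)\<^esub> = u\<close> on paper.\<close>

definition pattern_at :: "'a tree \<Rightarrow> word \<Rightarrow> (word \<rightharpoonup> 'a) \<Rightarrow> bool" where
  "pattern_at t x u \<longleftrightarrow> (\<forall>y\<in>dom u. u y = Some (t (x @ y)))"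

definition avoids :: "'a tree \<Rightarrow> (word \<rightharpoonup> 'a) \<Rightarrow> bool" where
  "avoids t u \<longleftrightarrow> (\<nexists>x. pattern_at t x u)"

definition shift_avoiding :: "(word \<rightharpoonup> 'a) set \<Rightarrow> 'a tree set" where
  "shift_avoiding F = {t. \<forall>u\<in>F. avoids t u}"

definition tree_shift :: "'a tree set \<Rightarrow> bool" where
  "tree_shift X \<longleftrightarrow> (\<exists>F. (\<forall>u\<in>F. is_pattern u) \<and> X = shift_avoiding F)"

text \<open>Blocks have size at least 1, so \<open>blocks 0 X\<close> is empty and a quantification over
  \<open>u \<in> blocks n X\<close> effectively ranges over \<open>n \<ge> 1\<close>.\<close>

definition is_block :: "nat \<Rightarrow> (word \<rightharpoonup> 'a) \<Rightarrow> bool" where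
  "is_block n u \<longleftrightarrow> 1 \<le> n \<and> is_pattern u \<and> dom u = words_upto (n - 1)"

definition blocks :: "nat \<Rightarrow> 'a tree set \<Rightarrow> (word \<rightharpoonup> 'a) set" where
  "blocks n X = {u. is_block n u \<and> (\<exists>t\<in>X. \<exists>x. pattern_at t x u)}"

definition prefix_set :: "word set \<Rightarrow> bool" where
  "prefix_set P \<longleftrightarrow> (\<forall>x\<in>P. \<forall>y\<in>P. prefix x y \<longrightarrow> x = y)"

text \<open>The empty set is not complete, whatever the value of \<open>Max {}\<close>, because some word is long
  enough but has no prefix in it.\<close>

definition complete_prefix_set :: "word set \<Rightarrow> bool" where
  "complete_prefix_set P \<longleftrightarrow>
     finite P \<and> prefix_set P \<and>
     (\<forall>x. length x \<ge> Max (length ` P) \<longrightarrow> (\<exists>p\<in>P. prefix p x))"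

definition irreducible_shift :: "'a tree set \<Rightarrow> bool" where
  "irreducible_shift X \<longleftrightarrow>
     (\<forall>n. \<forall>u\<in>blocks n X. \<forall>v\<in>blocks n X.
        \<exists>t\<in>X. \<exists>P. complete_prefix_set P \<and> P \<subseteq> (\<Union>k\<in>{n..}. words k) \<and>
          pattern_at t [] u \<and> (\<forall>x\<in>P. pattern_at t x v))"

end

theory Submission
  imports Defs
begin

text \<open>Restricting and enlarging blocks makes their sizes immaterial. Given \<open>u \<in> B\<^sub>n(X)\<close> and
  \<open>v \<in> B\<^sub>m(X)\<close>, irreducibility applied to extensions of both to size \<open>max n m\<close> yields a complete
  prefix set \<open>P\<close> of words longer than \<open>n - 1\<close>, and the quotients \<open>w\<^sup>-\<^sup>1P\<close> are the sets required
  in (ii). Conversely, (ii) applied to an extension of \<open>u\<close> to size \<open>n + 1\<close> gives the complete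
  prefix set \<open>\<Union>\<^sub>w wP\<^sub>w\<close>, whose words have length at least \<open>n\<close>. Conditions (ii) and (iii) differ
  only by reindexing along the finite set of words of length \<open>n - 1\<close>.\<close>

lemma finite_words: "finite (words n)"
  using finite_lists_length_eq[of "UNIV :: bool set" n] by (simp add: words_def)

lemma words_upto_eq: "words_upto n = {x. length x \<le> n}"
  by (auto simp: words_upto_def words_def)

lemma finite_words_upto: "finite (words_upto n)"
  by (simp add: words_upto_def finite_words)

text \<open>Unlike the definition, this characterisation involves no maximal length.\<close>

lemma complete_prefix_set_iff:
  "complete_prefix_set P \<longleftrightarrow>
     finite P \<and> prefix_set P \<and> (\<forall>x. \<exists>p\<in>P. prefix p x \<or> prefix x p)"
proof (intro iffI conjI allI)
  fix x
  assume P: "complete_prefix_set P"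
  \<comment> \<open>Padding makes \<open>y\<close> long enough to have a prefix in \<open>P\<close>;
    that prefix and \<open>x\<close> are comparable because both are prefixes of
    \<open>y\<close>.\<close>
  define y where "y = x @ replicate (Max (length ` P)) False"
  have "length y \<ge> Max (length ` P)"
    by (simp add: y_def)
  with P obtain p where "p \<in> P" "prefix p y"
    unfolding complete_prefix_set_def by blast
  moreover have "prefix x y"
    by (simp add: y_def)
  ultimately show "\<exists>p\<in>P. prefix p x \<or> prefix x p"
    using prefix_same_cases by blast
next
  assume P: "finite P \<and> prefix_set P \<and> (\<forall>x. \<exists>p\<in>P. prefix p x \<or> prefix x p)"
  have "\<exists>p\<in>P. prefix p x" if x: "length x \<ge> Max (length ` P)" for x
  proof -
    obtain p where p: "p \<in> P" "prefix p x \<or> prefix x p"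
      using P by blast
    have "length p \<le> length x"
      using P p(1) x by (meson Max_ge finite_imageI imageI le_trans)
    then have "prefix p x"
      using p(2) by (auto simp: prefix_def)
    then show ?thesis
      using p(1) by blast
  qed
  with P show "complete_prefix_set P"
    by (simp add: complete_prefix_set_def)
qed (auto simp: complete_prefix_set_def)

text \<open>An element of \<open>P\<close> comparable with \<open>w @ x\<close> and no shorter than
  \<open>w\<close> begins with \<open>w\<close>, and its remainder is comparable with
  \<open>x\<close>. An element of \<open>P\<close> that is a proper prefix of \<open>w\<close> would
  leave the quotient empty.\<close>

lemma complete_prefix_set_quotient:
  assumes P: "complete_prefix_set P" and long: "\<And>p. p \<in> P \<Longrightarrow> length w \<le> length p"
  shows "complete_prefix_set {x. w @ x \<in> P}"
  unfolding complete_prefix_set_iff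
proof (intro conjI allI)
  have "finite ((@) w -` P)"
    using P by (intro finite_vimageI) (auto simp: complete_prefix_set_def inj_on_def)
  then show "finite {x. w @ x \<in> P}"
    by (simp add: vimage_def)
  show "prefix_set {x. w @ x \<in> P}"
    using P by (fastforce simp: complete_prefix_set_def prefix_set_def)
  fix x
  obtain p where p: "p \<in> P" "prefix p (w @ x) \<or> prefix (w @ x) p"
    using P unfolding complete_prefix_set_iff by blast
  have "prefix w p"
    using p(2) long[OF p(1)] by (metis append_prefixD prefixI prefix_length_prefix)
  then obtain q where "p = w @ q"
    by (auto simp: prefix_def)
  with p show "\<exists>q\<in>{x. w @ x \<in> P}. prefix q x \<or> prefix x q"
    by auto
qed

text \<open>All first factors have length \<open>n\<close>, so comparable concatenations share their
  first factor, and the comparison takes place inside a single \<open>P w\<close>.\<close>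

lemma complete_prefix_set_concat:
  assumes P: "\<And>w. w \<in> words n \<Longrightarrow> complete_prefix_set (P w)"
  shows "complete_prefix_set (\<Union>w\<in>words n. (@) w ` P w)"
  unfolding complete_prefix_set_iff
proof (intro conjI allI)
  show "finite (\<Union>w\<in>words n. (@) w ` P w)"
    using P finite_words by (auto simp: complete_prefix_set_def)
  show "prefix_set (\<Union>w\<in>words n. (@) w ` P w)"
    unfolding prefix_set_def
  proof (intro ballI impI)
    fix a b
    assume "a \<in> (\<Union>w\<in>words n. (@) w ` P w)" "b \<in> (\<Union>w\<in>words n. (@) w ` P w)"
    then obtain w w' p p' where
      *: "w \<in> words n" "w' \<in> words n" "p \<in> P w" "p' \<in> P w'" "a = w @ p" "b = w' @ p'"
      by auto
    assume "prefix a b"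
    with * have "w = w'" "prefix p p'"
      by (auto simp: words_def prefix_def)
    with * P[of w] show "a = b"
      by (auto simp: complete_prefix_set_def prefix_set_def)
  qed
  fix x :: word
  \<comment> \<open>The word \<open>x\<close> may be shorter than \<open>n\<close>; the padding
    supplies a first factor. Whatever is comparable with \<open>y\<close> is also comparable with
    its prefix \<open>x\<close>.\<close>
  define y where "y = x @ replicate n False"
  have w: "take n y \<in> words n"
    by (simp add: y_def words_def)
  then obtain p where "p \<in> P (take n y)" "prefix p (drop n y) \<or> prefix (drop n y) p"
    using P[OF w] unfolding complete_prefix_set_iff by blast
  moreover from this have "prefix (take n y @ p) y \<or> prefix y (take n y @ p)"
    by (metis append_take_drop_id same_prefix_prefix)
  moreover have "prefix x y"
    by (simp add: y_def)
  ultimately show "\<exists>p\<in>\<Union>w\<in>words n. (@) w ` P w. prefix p x \<or> prefix x p"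
    using w by (meson UN_I imageI prefix_order.trans prefix_same_cases)
qed

text \<open>The larger block is read off the tree in which \<open>u\<close> occurs, at the same
  node.\<close>

lemma blocks_extend:
  assumes u: "u \<in> blocks n X" and "n \<le> N"
  obtains u' where "u' \<in> blocks N X" "\<And>t x. pattern_at t x u' \<Longrightarrow> pattern_at t x u"
proof -
  from u obtain s z where s: "s \<in> X" "pattern_at s z u"
    and n: "1 \<le> n" "dom u = words_upto (n - 1)"
    by (auto simp: blocks_def is_block_def)
  define u' where "u' = (\<lambda>y. Some (s (z @ y))) |` words_upto (N - 1)"
  have dom: "dom u' = words_upto (N - 1)"
    by (simp add: u'_def)
  have "prefix_closed (words_upto (N - 1))"
    by (auto simp: prefix_closed_def words_upto_eq dest: prefix_length_le)
  then have "is_block N u'"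
    using n \<open>n \<le> N\<close> by (simp add: is_block_def is_pattern_def dom finite_words_upto)
  moreover have "pattern_at s z u'"
    by (auto simp: pattern_at_def dom) (simp add: u'_def)
  ultimately have "u' \<in> blocks N X"
    using s by (auto simp: blocks_def)
  moreover have "pattern_at t x u" if "pattern_at t x u'" for t x
    unfolding pattern_at_def
  proof
    fix y
    assume y: "y \<in> dom u"
    then have "y \<in> words_upto (N - 1)"
      using n \<open>n \<le> N\<close> by (auto simp: words_upto_eq)
    \<comment> \<open>Two readings of \<open>u' y\<close> identify the label of \<open>t\<close> at
      \<open>x @ y\<close> with that of \<open>s\<close> at \<open>z @ y\<close>, which is
      \<open>u y\<close>.\<close>
    then have "u' y = Some (t (x @ y))" "u' y = Some (s (z @ y))"
      using that dom by (auto simp: pattern_at_def u'_def)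
    then show "u y = Some (t (x @ y))"
      using s y by (auto simp: pattern_at_def)
  qed
  ultimately show thesis
    using that by blast
qed

lemma irreducible_shift_iff_families:
  "irreducible_shift X \<longleftrightarrow>
     (\<forall>n m. \<forall>u\<in>blocks n X. \<forall>v\<in>blocks m X.
        \<exists>(P :: word \<Rightarrow> word set). \<exists>t\<in>X.
          (\<forall>w\<in>words (n - 1). complete_prefix_set (P w)) \<and>
          pattern_at t [] u \<and>
          (\<forall>w\<in>words (n - 1). \<forall>x\<in>P w. pattern_at t (w @ x) v))"
    (is "_ \<longleftrightarrow> (\<forall>n m. \<forall>u\<in>_. \<forall>v\<in>_. ?Q n u v)")
proof
  assume irr: "irreducible_shift X"
  show "\<forall>n m. \<forall>u\<in>blocks n X. \<forall>v\<in>blocks m X. ?Q n u v"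
  proof (intro allI ballI)
    fix n m u v
    assume u: "u \<in> blocks n X" and v: "v \<in> blocks m X"
    \<comment> \<open>Irreducibility needs blocks of one common size; \<open>n \<le> N\<close> also
      makes the words of \<open>P\<close> long enough for the quotients by words of length
      \<open>n - 1\<close>.\<close>
    define N where "N = max n m"
    obtain u' where u': "u' \<in> blocks N X" "\<And>t x. pattern_at t x u' \<Longrightarrow> pattern_at t x u"
      using blocks_extend[OF u, of N] by (auto simp: N_def)
    obtain v' where v': "v' \<in> blocks N X" "\<And>t x. pattern_at t x v' \<Longrightarrow> pattern_at t x v"
      using blocks_extend[OF v, of N] by (auto simp: N_def)
    obtain t P where t: "t \<in> X" "complete_prefix_set P" "P \<subseteq> (\<Union>k\<in>{N..}. words k)"
      "pattern_at t [] u'" "\<forall>x\<in>P. pattern_at t x v'"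
      using irr u'(1) v'(1) unfolding irreducible_shift_def by blast
    have "complete_prefix_set {x. w @ x \<in> P}" if "w \<in> words (n - 1)" for w
    proof (rule complete_prefix_set_quotient[OF t(2)])
      fix p
      assume "p \<in> P"
      then have "N \<le> length p"
        using t(3) by (auto simp: words_def)
      then show "length w \<le> length p"
        using that by (simp add: words_def N_def) linarith
    qed
    then show "?Q n u v"
      using t u'(2) v'(2) by (intro exI[of _ "\<lambda>w. {x. w @ x \<in> P}"] bexI[of _ t]) auto
  qed
next
  assume fam: "\<forall>n m. \<forall>u\<in>blocks n X. \<forall>v\<in>blocks m X. ?Q n u v"
  show "irreducible_shift X"
    unfolding irreducible_shift_def
  proof (intro allI ballI)
    fix n u v
    assume u: "u \<in> blocks n X" and v: "v \<in> blocks n X"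
    \<comment> \<open>One extra level makes the indexing words have length \<open>n\<close> instead
      of \<open>n - 1\<close>, so every concatenation has length at least \<open>n\<close>, even if
      some \<open>P w\<close> contains the empty word.\<close>
    obtain u' where u': "u' \<in> blocks (Suc n) X"
      "\<And>t x. pattern_at t x u' \<Longrightarrow> pattern_at t x u"
      using blocks_extend[OF u, of "Suc n"] by auto
    from fam u'(1) v have "?Q (Suc n) u' v"
      by blast
    then obtain P t where t: "t \<in> X" "\<And>w. w \<in> words n \<Longrightarrow> complete_prefix_set (P w)"
      "pattern_at t [] u'" "\<forall>w\<in>words n. \<forall>x\<in>P w. pattern_at t (w @ x) v"
      by auto
    let ?P = "\<Union>w\<in>words n. (@) w ` P w"
    have "?P \<subseteq> (\<Union>k\<in>{n..}. words k)"
      by (auto simp: words_def)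
    moreover have "\<forall>x\<in>?P. pattern_at t x v"
      using t(4) by auto
    moreover have "complete_prefix_set ?P"
      by (rule complete_prefix_set_concat[OF t(2)])
    ultimately show "\<exists>t\<in>X. \<exists>P. complete_prefix_set P \<and> P \<subseteq> (\<Union>k\<in>{n..}. words k) \<and>
        pattern_at t [] u \<and> (\<forall>x\<in>P. pattern_at t x v)"
      using u'(2)[OF t(3)] by (intro bexI[OF _ t(1)] exI[of _ ?P] conjI)
  qed
qed

text \<open>Forward, \<open>W\<close> is enumerated by \<open>{1..card W}\<close>; backward, each
  \<open>w\<close> chooses an index that serves it, and several \<open>w\<close> may share one. Here
  \<open>C\<close> stands for completeness and \<open>R w\<close> for the occurrence of
  \<open>v\<close> below \<open>w\<close>.\<close>

lemma finite_family_reindex: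
  assumes "finite W"
  shows "(\<exists>P. (\<forall>w\<in>W. C (P w)) \<and> (\<forall>w\<in>W. R w (P w))) \<longleftrightarrow>
         (\<exists>(l :: nat) P. (\<forall>k\<in>{1..l}. C (P k)) \<and> (\<forall>w\<in>W. \<exists>k\<in>{1..l}. R w (P k)))"
    (is "?L \<longleftrightarrow> ?R")
proof
  assume ?L
  then obtain P where P: "\<forall>w\<in>W. C (P w)" "\<forall>w\<in>W. R w (P w)"
    by blast
  obtain h where h: "bij_betw h {1..card W} W"
    using ex_bij_betw_nat_finite_1[OF assms] by blast
  have "\<forall>k\<in>{1..card W}. C (P (h k))"
    using P(1) h by (auto simp: bij_betw_def)
  moreover have "\<forall>w\<in>W. \<exists>k\<in>{1..card W}. R w (P (h k))"
    using P(2) h by (metis bij_betw_def imageE)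
  ultimately show ?R
    by (intro exI[of _ "card W"] exI[of _ "P \<circ> h"]) simp
next
  assume ?R
  then obtain l P where P: "\<forall>k\<in>{1..l::nat}. C (P k)" "\<forall>w\<in>W. \<exists>k\<in>{1..l}. R w (P k)"
    by blast
  then obtain k where "\<forall>w\<in>W. k w \<in> {1..l} \<and> R w (P (k w))"
    by metis
  with P(1) show ?L
    by (intro exI[of _ "P \<circ> k"]) auto
qed

theorem theorem3p3:
  fixes X :: "('a::finite) tree set"
  assumes "tree_shift X"
  shows
    "(irreducible_shift X \<longleftrightarrow>
       (\<forall>n m. \<forall>u\<in>blocks n X. \<forall>v\<in>blocks m X.
          \<exists>(P :: word \<Rightarrow> word set). \<exists>t\<in>X.
            (\<forall>w\<in>words (n - 1). complete_prefix_set (P w)) \<and>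
            pattern_at t [] u \<and>
            (\<forall>w\<in>words (n - 1). \<forall>x\<in>P w. pattern_at t (w @ x) v)))
     \<and>
     (irreducible_shift X \<longleftrightarrow>
       (\<forall>n m. \<forall>u\<in>blocks n X. \<forall>v\<in>blocks m X.
          \<exists>(l :: nat) (P :: nat \<Rightarrow> word set). \<exists>t\<in>X.
            (\<forall>k\<in>{1..l}. complete_prefix_set (P k)) \<and>
            pattern_at t [] u \<and>
            (\<forall>w\<in>words (n - 1). \<exists>k\<in>{1..l}. \<forall>x\<in>P k. pattern_at t (w @ x) v)))"
proof -
  have "(\<exists>(P :: word \<Rightarrow> word set). \<exists>t\<in>X. (\<forall>w\<in>words (n - 1). complete_prefix_set (P w)) \<and>
          pattern_at t [] u \<and> (\<forall>w\<in>words (n - 1). \<forall>x\<in>P w. pattern_at t (w @ x) v)) \<longleftrightarrow>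
        (\<exists>(l :: nat) (P :: nat \<Rightarrow> word set). \<exists>t\<in>X. (\<forall>k\<in>{1..l}. complete_prefix_set (P k)) \<and>
          pattern_at t [] u \<and>
          (\<forall>w\<in>words (n - 1). \<exists>k\<in>{1..l}. \<forall>x\<in>P k. pattern_at t (w @ x) v))"
    (is "?L \<longleftrightarrow> ?R") for n :: nat and u v :: "word \<rightharpoonup> 'a"
  proof -
    \<comment> \<open>With \<open>t\<close> and the condition on \<open>u\<close> moved to the
      front, what remains for each fixed \<open>t\<close> has the shape of the reindexing
      lemma.\<close>
    have "?L \<longleftrightarrow> (\<exists>t\<in>X. pattern_at t [] u \<and>
        (\<exists>P. (\<forall>w\<in>words (n - 1). complete_prefix_set (P w)) \<and>
          (\<forall>w\<in>words (n - 1). \<forall>x\<in>P w. pattern_at t (w @ x) v)))"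
      by fast
    also have "\<dots> \<longleftrightarrow> (\<exists>t\<in>X. pattern_at t [] u \<and>
        (\<exists>(l :: nat) P. (\<forall>k\<in>{1..l}. complete_prefix_set (P k)) \<and>
          (\<forall>w\<in>words (n - 1). \<exists>k\<in>{1..l}. \<forall>x\<in>P k. pattern_at t (w @ x) v)))"
      by (intro bex_cong refl conj_cong finite_family_reindex finite_words)
    also have "\<dots> \<longleftrightarrow> ?R"
      by fast
    finally show ?thesis .
  qed
  then show ?thesis
    by (simp only: irreducible_shift_iff_families simp_thms)
qed

end
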